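(* Let $n\ge 1$, let $\alpha_1,\ldots,\alpha_n\ge 1$ be real numbers, let $\alpha:=\max\{\alpha_1,\ldots,\alpha_n\}$, and let $M>0$. Consider the class of all functions $$F(z):=\int_0^z\prod_{i=1}^n\left(f_i'(t)\right)^{\gamma_i}\,dt\qquad(z\in\Delta),$$ where $f_i\in\mathcal{U}_{\alpha_i}$ $(1\le i\le n)$ and $\gamma_1,\ldots,\gamma_n\in\mathbb{C}$ satisfy $\sum_{i=1}^n|\gamma_i|\le M$. Then the radius of convexity of this class of integral operators is $$r_c(F)=\frac{\sqrt{\alpha^2M^2+2M+1}-\alpha M}{2M+1}.$$
   Context: $\Delta=\{z\in\mathbb{C}:|z|<1\}$. $\mathcal{A}$ is the set of functions $f$ analytic in $\Delta$ with $f(z)=z+a_2z^2+\cdots$; write $a_2(f)$ for the coefficient of $z^2$. $\mathrm{Aut}(\Delta)$ is the set of all maps $\phi(z)=e^{i\theta}\frac{z+a}{1+\bar a z}$ with $a\in\Delta$, $\theta\in\mathbb{R}$. For locally univalent $f\in\mathcal{A}$ (i.e. $f'\neq0$ in $\Delta$) and $\phi\in\mathrm{Aut}(\Delta)$ put $$F_\phi(f)(z)=\frac{f(\phi(z))-f(\phi(0))}{f'(\phi(0))\phi'(0)},\qquad \mathrm{ord}\,f=\sup_{\phi\in \mathrm{Aut}(\Delta)}|a_2(F_\phi(f))|.$$ For $\alpha\ge1$, $\mathcal{U}_\alpha$ (the universal linear invariant family of order $\alpha$) is the set of locally univalent $f\in\mathcal{A}$ with $\mathrm{ord}\,f\le\alpha$.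 The powers $(f_i')^{\gamma_i}$ are the analytic branches equal to $1$ at the origin. The radius of convexity of a class of such functions $F$ is the largest number $r\in(0,1)$ for which $\min_{|z|=r}\mathrm{Re}\left\{1+\frac{zF''(z)}{F'(z)}\right\}\ge 0$ for every $F$ in the class. *)

theory Defs
  imports "HOL-Complex_Analysis.Complex_Analysis"
begin

text \<open>
  Functions on the open unit disc are total functions on \<^typ>\<open>complex\<close>; only their values on
  the disc matter.
\<close>

abbreviation unit_disc :: "complex set" ("\<Delta>")
  where "\<Delta> \<equiv> ball 0 1"

definition normalized_functions :: "(complex \<Rightarrow> complex) set" ("\<A>")
  where "\<A> = {f. f holomorphic_on \<Delta> \<and> f 0 = 0 \<and> deriv f 0 = 1}"

definition a2 :: "(complex \<Rightarrow> complex) \<Rightarrow> complex"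
  where "a2 f = fps_nth (fps_expansion f 0) 2"

definition disc_automorphisms :: "(complex \<Rightarrow> complex) set"
  where "disc_automorphisms =
    {\<phi>. \<exists>a \<theta>. a \<in> \<Delta> \<and> \<phi> = (\<lambda>z. cis \<theta> * ((z + a) / (1 + cnj a * z)))}"

definition koebe_transform :: "(complex \<Rightarrow> complex) \<Rightarrow> (complex \<Rightarrow> complex) \<Rightarrow> complex \<Rightarrow> complex"
  where "koebe_transform \<phi> f = (\<lambda>z. (f (\<phi> z) - f (\<phi> 0)) / (deriv f (\<phi> 0) * deriv \<phi> 0))"

text \<open>The order may be infinite, so the supremum is taken in the extended reals.\<close>

definition lif_order :: "(complex \<Rightarrow> complex) \<Rightarrow> ereal"
  where "lif_order f = (SUP \<phi>\<in>disc_automorphisms. ereal (cmod (a2 (koebe_transform \<phi> f))))"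

definition universal_lif :: "real \<Rightarrow> (complex \<Rightarrow> complex) set" ("\<U>")
  where "\<U> \<alpha> = {f \<in> \<A>. (\<forall>z\<in>\<Delta>. deriv f z \<noteq> 0) \<and> lif_order f \<le> ereal \<alpha>}"

text \<open>
  An analytic branch of \<open>g\<^sup>\<gamma>\<close> on the disc that equals 1 at the origin is \<open>exp (\<gamma> L)\<close>
  for an analytic logarithm \<open>L\<close> of \<open>g\<close>. For holomorphic zero-free \<open>g\<close> with \<open>g 0 = 1\<close> it
  exists and is unique on the disc, as the two lemmas below show.
\<close>

definition is_power_branch :: "(complex \<Rightarrow> complex) \<Rightarrow> complex \<Rightarrow> (complex \<Rightarrow> complex) \<Rightarrow> bool"
  where "is_power_branch g \<gamma> h \<longleftrightarrow>
    (\<exists>L. L holomorphic_on \<Delta> \<and> (\<forall>z\<in>\<Delta>. exp (L z) = g z) \<and> (\<forall>z\<in>\<Delta>. h z = exp (\<gamma> * L z)))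
    \<and> h 0 = 1"

definition power_branch :: "(complex \<Rightarrow> complex) \<Rightarrow> complex \<Rightarrow> complex \<Rightarrow> complex"
  where "power_branch g \<gamma> = (SOME h. is_power_branch g \<gamma> h)"

lemma is_power_branch_power_branch:
  assumes "g holomorphic_on \<Delta>" "\<And>z. z \<in> \<Delta> \<Longrightarrow> g z \<noteq> 0" "g 0 = 1"
  shows "is_power_branch g \<gamma> (power_branch g \<gamma>)"
proof -
  obtain L where L: "L holomorphic_on \<Delta>" "\<And>z. z \<in> \<Delta> \<Longrightarrow> g z = exp (L z)"
    using contractible_imp_holomorphic_log[OF assms(1) convex_imp_contractible[OF convex_ball] assms(2)]
    by blast
  define L' where "L' = (\<lambda>z. L z - L 0)"
  have "exp (L 0) = 1" using L(2)[of 0] assms(3) by simp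
  then have "is_power_branch g \<gamma> (\<lambda>z. exp (\<gamma> * L' z))"
    unfolding is_power_branch_def
    by (intro conjI exI[of _ L'])
       (auto simp: L'_def exp_diff L(2) intro!: holomorphic_intros L(1))
  then show ?thesis
    unfolding power_branch_def by (rule someI[where P = "is_power_branch g \<gamma>"])
qed

lemma is_power_branch_unique:
  assumes h: "is_power_branch g \<gamma> h" and k: "is_power_branch g \<gamma> k" and z: "z \<in> \<Delta>"
  shows "h z = k z"
proof -
  obtain L where L: "L holomorphic_on \<Delta>" "\<And>z. z \<in> \<Delta> \<Longrightarrow> exp (L z) = g z"
      "\<And>z. z \<in> \<Delta> \<Longrightarrow> h z = exp (\<gamma> * L z)"
    using h unfolding is_power_branch_def by blast
  obtain K where K: "K holomorphic_on \<Delta>" "\<And>z. z \<in> \<Delta> \<Longrightarrow> exp (K z) = g z"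
      "\<And>z. z \<in> \<Delta> \<Longrightarrow> k z = exp (\<gamma> * K z)"
    using k unfolding is_power_branch_def by blast
  have "(\<lambda>z. L z - K z) constant_on \<Delta>"
  proof (rule continuous_discrete_range_constant)
    show "connected \<Delta>" by simp
    show "continuous_on \<Delta> (\<lambda>z. L z - K z)"
      by (intro continuous_intros holomorphic_on_imp_continuous_on L(1) K(1))
    fix x :: complex assume x: "x \<in> \<Delta>"
    have int: "exp (L y - K y) = 1" if "y \<in> \<Delta>" for y
      using L(2)[OF that] K(2)[OF that] by (metis exp_diff exp_not_eq_zero divide_self)
    show "\<exists>e>0. \<forall>y. y \<in> \<Delta> \<and> L y - K y \<noteq> L x - K x \<longrightarrow> e \<le> norm ((L y - K y) - (L x - K x))"
    proof (intro exI[of _ "1::real"] conjI allI impI)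
      fix y assume y: "y \<in> \<Delta> \<and> L y - K y \<noteq> L x - K x"
      let ?w = "(L y - K y) - (L x - K x)"
      have "exp ?w = 1" using int[of y] int[OF x] y by (simp add: exp_diff)
      then obtain n :: int where n: "Re ?w = 0" "Im ?w = of_int (2 * n) * pi"
        unfolding exp_eq_1 by blast
      have "n \<noteq> 0" using n y by (auto simp: complex_eq_iff)
      then have "1 \<le> \<bar>of_int n :: real\<bar>" by linarith
      then have "1 \<le> \<bar>Im ?w\<bar>"
        unfolding n(2) using pi_ge_two by (simp add: abs_mult mult_ge1_I)
      then show "1 \<le> norm ?w" using abs_Im_le_cmod order_trans by blast
    qed simp
  qed
  then obtain c where c: "\<And>z. z \<in> \<Delta> \<Longrightarrow> L z - K z = c"
    unfolding constant_on_def by blast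
  have quot: "h z = exp (\<gamma> * c) * k z" if "z \<in> \<Delta>" for z
    using c[OF that] L(3)[OF that] K(3)[OF that]
    by (simp flip: exp_add distrib_left) (metis add.commute diff_add_cancel)
  have "h 0 = 1" "k 0 = 1" using h k unfolding is_power_branch_def by auto
  then have "exp (\<gamma> * c) = 1" using quot[of 0] by simp
  then show ?thesis using quot[OF z] by simp
qed

definition integral_operator ::
    "nat \<Rightarrow> (nat \<Rightarrow> complex \<Rightarrow> complex) \<Rightarrow> (nat \<Rightarrow> complex) \<Rightarrow> complex \<Rightarrow> complex"
  where "integral_operator n f \<gamma> = (\<lambda>z. contour_integral (linepath 0 z)
    (\<lambda>t. \<Prod>i=1..n. power_branch (deriv (f i)) (\<gamma> i) t))"

definition integral_operator_class ::
    "nat \<Rightarrow> (nat \<Rightarrow> real) \<Rightarrow> real \<Rightarrow> (complex \<Rightarrow> complex) set"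
  where "integral_operator_class n \<alpha> M =
    {integral_operator n f \<gamma> | f \<gamma>. (\<forall>i\<in>{1..n}. f i \<in> \<U> (\<alpha> i)) \<and> (\<Sum>i=1..n. cmod (\<gamma> i)) \<le> M}"

text \<open>
  That the minimum over the circle is nonnegative is expressed by nonnegativity at each of its points.
\<close>

definition convex_radius_admissible :: "(complex \<Rightarrow> complex) set \<Rightarrow> real \<Rightarrow> bool"
  where "convex_radius_admissible \<F> r \<longleftrightarrow> 0 < r \<and> r < 1 \<and>
    (\<forall>F\<in>\<F>. \<forall>z. cmod z = r \<longrightarrow> Re (1 + z * deriv (deriv F) z / deriv F z) \<ge> 0)"

definition is_radius_of_convexity :: "(complex \<Rightarrow> complex) set \<Rightarrow> real \<Rightarrow> bool"
  where "is_radius_of_convexity \<F> r \<longleftrightarrow>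
    convex_radius_admissible \<F> r \<and> (\<forall>s. convex_radius_admissible \<F> s \<longrightarrow> s \<le> r)"

end

(* The coefficient a_2 of the Koebe transform of f at b is, up to a unimodular factor,
   half of (1 - |b|^2) f''(b)/f'(b) - 2 conj(b); hence f lies in U_alpha iff this quantity is
   bounded by 2 alpha on the disc, and then |f''/f'| <= (2 alpha + 2 r)/(1 - r^2) on |z| = r.
   Since F''/F' is the sum of the gamma_i f_i''/f_i', the real part in question is at least
   1 - M (2 alpha r + 2 r^2)/(1 - r^2), and the claimed radius is the positive zero of that
   bound. Equality holds at z = r for the generalized Koebe function
   f'(z) = (1 + z)^(alpha - 1)/(1 - z)^(alpha + 1) with exponent -M. *)

theory Submission
  imports Defs
begin

section \<open>Koebe transforms and the order as a bound on the pre-Schwarzian derivative\<close>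

lemma deriv_deriv_eqI:
  assumes "open S" "z \<in> S"
    and "\<And>w. w \<in> S \<Longrightarrow> (f has_field_derivative g w) (at w)"
    and "(g has_field_derivative d) (at z)"
  shows "deriv (deriv f) z = d"
proof (rule DERIV_imp_deriv, rule has_field_derivative_transform_within_open[OF assms(4,1,2)])
  show "g w = deriv f w" if "w \<in> S" for w
    using DERIV_imp_deriv[OF assms(3)[OF that]] by simp
qed

lemma one_plus_cnj_mult_nonzero:
  assumes "a \<in> \<Delta>" "z \<in> \<Delta>"
  shows "1 + cnj a * z \<noteq> 0"
proof
  assume "1 + cnj a * z = 0"
  then have "cmod (cnj a * z) = 1"
    by (metis add_eq_0_iff norm_minus_cancel norm_one)
  moreover have "cmod a * cmod z < 1 * 1"
    using assms by (intro mult_strict_mono') auto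
  ultimately show False
    by (simp add: norm_mult)
qed

text \<open>Chain rule at the origin: \<open>\<phi>\<close> sends 0 to \<open>b\<close>, has first
  derivative \<open>cis \<theta> * k\<close> there with k = 1 - |a|^2, and second derivative
  \<open>- 2 * cnj a\<close> times the first. Since |a| = |b| and
  \<open>cnj a = cis \<theta> * cnj b\<close>, the rotation factors out.\<close>

lemma a2_koebe_transform:
  fixes a b :: complex and \<theta> :: real
  defines "b \<equiv> cis \<theta> * a"
  assumes f: "f holomorphic_on \<Delta>" and a: "a \<in> \<Delta>" and nz: "deriv f b \<noteq> 0"
  shows "a2 (koebe_transform (\<lambda>z. cis \<theta> * ((z + a) / (1 + cnj a * z))) f) =
    cis \<theta> / 2 * ((1 - (cmod b)\<^sup>2) * (deriv (deriv f) b / deriv f b) - 2 * cnj b)"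
proof -
  define \<phi> where "\<phi> = (\<lambda>z. cis \<theta> * ((z + a) / (1 + cnj a * z)))"
  define k where "k = 1 - complex_of_real ((cmod a)\<^sup>2)"
  have k: "k = 1 - cnj a * a"
    unfolding k_def complex_norm_square by (simp add: mult.commute)
  have "(cmod a)\<^sup>2 < 1"
    using a by (simp add: abs_square_less_1)
  then have k0: "k \<noteq> 0"
    unfolding k_def by (metis eq_iff_diff_eq_0 less_irrefl of_real_eq_1_iff)
  define \<phi>' where "\<phi>' = (\<lambda>z. cis \<theta> * k / (1 + cnj a * z)\<^sup>2)"
  have d\<phi>: "(\<phi> has_field_derivative \<phi>' z) (at z)" if "z \<in> \<Delta>" for z
    unfolding \<phi>_def \<phi>'_def k using one_plus_cnj_mult_nonzero[OF a that]
    by (auto intro!: derivative_eq_intros simp: field_simps power2_eq_square)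
  have d\<phi>': "(\<phi>' has_field_derivative (- 2 * cnj a * cis \<theta> * k)) (at 0)"
    unfolding \<phi>'_def by (auto intro!: derivative_eq_intros)
  have \<phi>0: "\<phi> 0 = b" "\<phi>' 0 = cis \<theta> * k"
    by (simp_all add: \<phi>_def \<phi>'_def b_def)
  have b: "b \<in> \<Delta>"
    using a by (simp add: b_def norm_mult)
  have f': "deriv f holomorphic_on \<Delta>"
    using f by (simp add: holomorphic_deriv)
  define c where "c = deriv f b * (cis \<theta> * k)"
  have c: "deriv f (\<phi> 0) * deriv \<phi> 0 = c"
    using DERIV_imp_deriv[OF d\<phi>[of 0]] by (simp add: c_def \<phi>0)
  have c0: "c \<noteq> 0"
    using nz k0 by (simp add: c_def)
  have K: "koebe_transform \<phi> f = (\<lambda>z. (f (\<phi> z) - f b) / c)"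
    unfolding koebe_transform_def c unfolding \<phi>0 ..
  \<comment> \<open>A neighbourhood of 0, open by continuity, that \<open>\<phi>\<close> maps into
    the disc; the second derivative at 0 depends only on values there.\<close>
  define S where "S = \<Delta> \<inter> \<phi> -` \<Delta>"
  have "continuous_on \<Delta> \<phi>"
    by (intro continuous_at_imp_continuous_on ballI DERIV_isCont[OF d\<phi>])
  then have S: "open S" "0 \<in> S"
    unfolding S_def using b \<phi>0 by (auto intro!: continuous_open_preimage)
  have dK: "(koebe_transform \<phi> f has_field_derivative deriv f (\<phi> z) * \<phi>' z / c) (at z)"
    if "z \<in> S" for z
    unfolding K using that c0 unfolding S_def
    by (auto intro!: derivative_eq_intros DERIV_chain2[where f = f, OF _ d\<phi>] holomorphic_derivI[OF f])
  have df\<phi>: "((\<lambda>z. deriv f (\<phi> z)) has_field_derivative deriv (deriv f) b * (cis \<theta> * k)) (at 0)"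
    using DERIV_chain2[OF holomorphic_derivI[OF f' open_ball b, unfolded \<phi>0(1)[symmetric]] d\<phi>[of 0]]
    by (simp add: \<phi>0)
  have ddK: "((\<lambda>z. deriv f (\<phi> z) * \<phi>' z / c) has_field_derivative
      (deriv (deriv f) b * (cis \<theta> * k) * (cis \<theta> * k) + deriv f b * (- 2 * cnj a * cis \<theta> * k)) / c) (at 0)"
    using DERIV_cdivide[OF DERIV_mult[OF df\<phi> d\<phi>'], of c] by (simp add: \<phi>0 mult_ac)
  have "deriv (deriv (koebe_transform \<phi> f)) 0 =
      (deriv (deriv f) b * (cis \<theta> * k) * (cis \<theta> * k) + deriv f b * (- 2 * cnj a * cis \<theta> * k)) / c"
    by (rule deriv_deriv_eqI[OF S dK ddK])
  also have "\<dots> = cis \<theta> * k * (deriv (deriv f) b / deriv f b) - 2 * cnj a"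
    using nz k0 by (simp add: c_def field_simps)
  also have "\<dots> = cis \<theta> * (k * (deriv (deriv f) b / deriv f b) - 2 * cnj b)"
  proof -
    have "cis \<theta> * cnj b = cnj a"
      by (simp add: b_def cis_cnj cis_mult flip: mult.assoc)
    from this[symmetric] show ?thesis
      by (simp add: algebra_simps)
  qed
  finally have "deriv (deriv (koebe_transform \<phi> f)) 0 =
      cis \<theta> * (k * (deriv (deriv f) b / deriv f b) - 2 * cnj b)" .
  moreover have "k = 1 - (cmod b)\<^sup>2"
    by (simp add: k_def b_def norm_mult)
  \<comment> \<open>The coefficient of z^2 is the second derivative at 0 divided by 2! = 2.\<close>
  ultimately show ?thesis
    unfolding \<phi>_def[symmetric] a2_def fps_expansion_def by (simp add: eval_nat_numeral)
qed

text \<open>The unimodular factor in \<open>a2_koebe_transform\<close> drops out of the modulus, and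
  the supremum over automorphisms turns into a pointwise bound because the points
  \<open>cis \<theta> * a\<close> are exactly the points of the disc.\<close>

lemma universal_lif_iff:
  "f \<in> \<U> \<alpha> \<longleftrightarrow> f \<in> \<A> \<and> (\<forall>z\<in>\<Delta>. deriv f z \<noteq> 0) \<and>
    (\<forall>b\<in>\<Delta>. cmod ((1 - (cmod b)\<^sup>2) * (deriv (deriv f) b / deriv f b) - 2 * cnj b) \<le> 2 * \<alpha>)"
proof -
  have "lif_order f \<le> ereal \<alpha> \<longleftrightarrow>
      (\<forall>b\<in>\<Delta>. cmod ((1 - (cmod b)\<^sup>2) * (deriv (deriv f) b / deriv f b) - 2 * cnj b) \<le> 2 * \<alpha>)"
    (is "_ \<longleftrightarrow> (\<forall>b\<in>\<Delta>. cmod (?q b) \<le> _)")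
    if f: "f \<in> \<A>" and nz: "\<forall>z\<in>\<Delta>. deriv f z \<noteq> 0"
  proof -
    have a2: "cmod (a2 (koebe_transform (\<lambda>z. cis \<theta> * ((z + a) / (1 + cnj a * z))) f))
        = cmod (?q (cis \<theta> * a)) / 2" if "a \<in> \<Delta>" for a \<theta>
    proof -
      have b: "cis \<theta> * a \<in> \<Delta>"
        using that by (simp add: norm_mult)
      show ?thesis
        using f nz b that
        by (subst a2_koebe_transform) (auto simp: normalized_functions_def norm_mult norm_divide)
    qed
    have "lif_order f \<le> ereal \<alpha> \<longleftrightarrow> (\<forall>a\<in>\<Delta>. \<forall>\<theta>.
        cmod (a2 (koebe_transform (\<lambda>z. cis \<theta> * ((z + a) / (1 + cnj a * z))) f)) \<le> \<alpha>)"
      unfolding lif_order_def SUP_le_iff disc_automorphisms_def ereal_less_eq by blast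
    also have "\<dots> \<longleftrightarrow> (\<forall>a\<in>\<Delta>. \<forall>\<theta>. cmod (?q (cis \<theta> * a)) / 2 \<le> \<alpha>)"
      by (intro ball_cong refl arg_cong[where f = All] ext) (simp only: a2)
    also have "\<dots> \<longleftrightarrow> (\<forall>b\<in>\<Delta>. cmod (?q b) / 2 \<le> \<alpha>)"
    proof safe
      fix b assume "\<forall>a\<in>\<Delta>. \<forall>\<theta>. cmod (?q (cis \<theta> * a)) / 2 \<le> \<alpha>" "b \<in> \<Delta>"
      then have "cmod (?q (cis 0 * b)) / 2 \<le> \<alpha>"
        by blast
      then show "cmod (?q b) / 2 \<le> \<alpha>"
        by simp
    next
      fix a :: complex and \<theta>
      assume "\<forall>b\<in>\<Delta>. cmod (?q b) / 2 \<le> \<alpha>" "a \<in> \<Delta>"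
      moreover from this have "cis \<theta> * a \<in> \<Delta>"
        by (simp add: norm_mult)
      ultimately show "cmod (?q (cis \<theta> * a)) / 2 \<le> \<alpha>"
        by blast
    qed
    finally show ?thesis
      by (simp add: mult.commute)
  qed
  then show ?thesis
    unfolding universal_lif_def by blast
qed

text \<open>The triangle inequality moves \<open>2 * cnj z\<close> to the other side of the
  criterion, which is then divided by 1 - |z|^2 > 0.\<close>

lemma universal_lif_pre_schwarzian_bound:
  assumes "f \<in> \<U> \<alpha>" "z \<in> \<Delta>"
  shows "cmod (deriv (deriv f) z / deriv f z) \<le> (2 * \<alpha> + 2 * cmod z) / (1 - (cmod z)\<^sup>2)"
proof -
  let ?p = "deriv (deriv f) z / deriv f z"
  have pos: "0 < 1 - (cmod z)\<^sup>2"
    using assms(2) by (simp add: abs_square_less_1)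
  have "(1 - (cmod z)\<^sup>2) * cmod ?p = cmod (complex_of_real (1 - (cmod z)\<^sup>2) * ?p)"
    unfolding norm_mult norm_of_real using pos by simp
  also have "\<dots> \<le> cmod ((1 - (cmod z)\<^sup>2) * ?p - 2 * cnj z) + cmod (2 * cnj z)"
    by (metis diff_add_cancel norm_triangle_ineq)
  also have "\<dots> \<le> 2 * \<alpha> + 2 * cmod z"
    using assms unfolding universal_lif_iff by (auto simp: norm_mult)
  finally show ?thesis
    using pos by (simp add: pos_le_divide_eq mult.commute)
qed

section \<open>Logarithmic derivatives of the powers and of the derivative of the integral
  operator\<close>

lemma power_branch_log_derivative:
  assumes "g holomorphic_on \<Delta>" "\<And>z. z \<in> \<Delta> \<Longrightarrow> g z \<noteq> 0" "g 0 = 1" and z: "z \<in> \<Delta>"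
  shows "power_branch g \<gamma> z \<noteq> 0"
    and "(power_branch g \<gamma> has_field_derivative power_branch g \<gamma> z * (\<gamma> * (deriv g z / g z))) (at z)"
proof -
  \<comment> \<open>With \<open>L\<close> the logarithm behind the branch, g = exp L gives g'/g =
    L', while exp (\<gamma> L) has logarithmic derivative \<gamma> L'.\<close>
  obtain L where L: "L holomorphic_on \<Delta>" "\<And>z. z \<in> \<Delta> \<Longrightarrow> exp (L z) = g z"
      "\<And>z. z \<in> \<Delta> \<Longrightarrow> power_branch g \<gamma> z = exp (\<gamma> * L z)"
    using is_power_branch_power_branch[OF assms(1-3), of \<gamma>] unfolding is_power_branch_def by blast
  show "power_branch g \<gamma> z \<noteq> 0"
    using L(3)[OF z] by simp
  have dL: "(L has_field_derivative deriv L z) (at z)"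
    using holomorphic_derivI[OF L(1) open_ball z] .
  have "((\<lambda>z. exp (L z)) has_field_derivative g z * deriv L z) (at z)"
    using DERIV_chain2[OF DERIV_exp dL] L(2)[OF z] by simp
  then have "(g has_field_derivative g z * deriv L z) (at z)"
    by (rule has_field_derivative_transform_within_open[OF _ open_ball z]) (use L(2) in auto)
  then have "deriv g z / g z = deriv L z"
    using DERIV_imp_deriv assms(2)[OF z] by fastforce
  moreover have "((\<lambda>z. exp (\<gamma> * L z)) has_field_derivative exp (\<gamma> * L z) * (\<gamma> * deriv L z)) (at z)"
    by (rule DERIV_chain2[OF DERIV_exp DERIV_cmult[OF dL]])
  then have "(power_branch g \<gamma> has_field_derivative exp (\<gamma> * L z) * (\<gamma> * deriv L z)) (at z)"
    by (rule has_field_derivative_transform_within_open[OF _ open_ball z]) (use L(3) in auto)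
  ultimately show "(power_branch g \<gamma> has_field_derivative
      power_branch g \<gamma> z * (\<gamma> * (deriv g z / g z))) (at z)"
    using L(3)[OF z] by simp
qed

text \<open>On a convex open set \<open>g\<close> has a primitive \<open>P\<close>, and every
  segment from \<open>a\<close> stays in the set, so the integral is
  \<open>P z - P a\<close>.\<close>

lemma has_field_derivative_contour_integral_linepath:
  assumes g: "g holomorphic_on S" and S: "open S" "convex S" and a: "a \<in> S" and z: "z \<in> S"
  shows "((\<lambda>z. contour_integral (linepath a z) g) has_field_derivative g z) (at z)"
proof -
  obtain P where P: "\<And>x. x \<in> S \<Longrightarrow> (P has_field_derivative g x) (at x within S)"
    using holomorphic_convex_primitive'[OF S(2,1) g] by blast
  have eq: "contour_integral (linepath a w) g = P w - P a" if "w \<in> S" for w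
  proof -
    have "path_image (linepath a w) \<subseteq> S"
      using closed_segment_subset[OF a that S(2)] by simp
    then show ?thesis
      using contour_integral_primitive[OF P valid_path_linepath, of a w]
      by (simp add: contour_integral_unique)
  qed
  have dP: "((\<lambda>w. P w - P a) has_field_derivative g z) (at z)"
    using P[OF z] at_within_open[OF z S(1)] by (auto intro!: derivative_eq_intros)
  show ?thesis
    by (rule has_field_derivative_transform_within_open[OF dP S(1) z]) (simp add: eq)
qed

text \<open>F' is the product of the powers, so F''/F' is the logarithmic derivative of a product
  and splits into a sum.\<close>

lemma integral_operator_pre_schwarzian:
  assumes f: "\<And>i. i \<in> {1..n} \<Longrightarrow> f i \<in> \<A>"
    and nz: "\<And>i z. i \<in> {1..n} \<Longrightarrow> z \<in> \<Delta> \<Longrightarrow> deriv (f i) z \<noteq> 0"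
    and z: "z \<in> \<Delta>"
  shows "deriv (deriv (integral_operator n f \<gamma>)) z / deriv (integral_operator n f \<gamma>) z =
    (\<Sum>i=1..n. \<gamma> i * (deriv (deriv (f i)) z / deriv (f i) z))"
proof -
  define g where "g = (\<lambda>t. \<Prod>i=1..n. power_branch (deriv (f i)) (\<gamma> i) t)"
  have hol: "deriv (f i) holomorphic_on \<Delta>" "deriv (f i) 0 = 1" if "i \<in> {1..n}" for i
    using f[OF that] by (auto simp: normalized_functions_def holomorphic_deriv)
  note pb = power_branch_log_derivative[OF hol(1) nz hol(2)]
  have dg: "(g has_field_derivative
      g w * (\<Sum>i=1..n. \<gamma> i * (deriv (deriv (f i)) w / deriv (f i) w))) (at w)" if "w \<in> \<Delta>" for w
  proof -
    have "(g has_field_derivative g w * (\<Sum>i=1..n. power_branch (deriv (f i)) (\<gamma> i) w *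
        (\<gamma> i * (deriv (deriv (f i)) w / deriv (f i) w)) / power_branch (deriv (f i)) (\<gamma> i) w)) (at w)"
      unfolding g_def by (rule has_field_derivative_prod') (use pb that in auto)
    also have "(\<Sum>i=1..n. power_branch (deriv (f i)) (\<gamma> i) w *
        (\<gamma> i * (deriv (deriv (f i)) w / deriv (f i) w)) / power_branch (deriv (f i)) (\<gamma> i) w) =
        (\<Sum>i=1..n. \<gamma> i * (deriv (deriv (f i)) w / deriv (f i) w))"
      using pb(1) that by (intro sum.cong refl) simp
    finally show ?thesis .
  qed
  have "g holomorphic_on \<Delta>"
    using dg unfolding holomorphic_on_open[OF open_ball] by blast
  then have dF: "(integral_operator n f \<gamma> has_field_derivative g w) (at w)" if "w \<in> \<Delta>" for w
    using has_field_derivative_contour_integral_linepath[of g \<Delta> 0 w] that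
    unfolding integral_operator_def g_def by simp
  have "g z \<noteq> 0"
    unfolding g_def using pb(1) z by simp
  then show ?thesis
    using deriv_deriv_eqI[OF open_ball z dF dg[OF z]] DERIV_imp_deriv[OF dF[OF z]] by simp
qed

section \<open>The extremal function and its membership in the universal family\<close>

lemma cmod_one_minus_square:
  "(cmod (1 - b\<^sup>2))\<^sup>2 = (1 - (cmod b)\<^sup>2)\<^sup>2 + 4 * (Im b)\<^sup>2"
  unfolding cmod_power2 minus_complex.sel one_complex.sel Re_power2 Im_power2 by algebra

lemma one_minus_square_nonzero:
  fixes z :: complex
  assumes "z \<in> \<Delta>"
  shows "1 - z\<^sup>2 \<noteq> 0"
proof
  assume "1 - z\<^sup>2 = 0"
  then have "(cmod z)\<^sup>2 = 1"
    by (metis eq_iff_diff_eq_0 norm_one norm_power)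
  then show False
    using assms abs_square_less_1[of "cmod z"] by simp
qed

text \<open>Here f' = exp L for a combination \<open>L\<close> of principal logarithms, so that
  f''/f' = L'. At real z in [0,1) this quotient equals the upper bound in
  \<open>universal_lif_pre_schwarzian_bound\<close>.\<close>

lemma generalized_koebe_function:
  fixes \<alpha> :: real
  assumes "\<alpha> \<ge> 1"
  obtains f where "f \<in> \<U> \<alpha>"
    and "\<And>z :: complex. z \<in> \<Delta> \<Longrightarrow> deriv (deriv f) z / deriv f z = (2 * \<alpha> + 2 * z) / (1 - z\<^sup>2)"
proof -
  define L where "L = (\<lambda>z :: complex. (\<alpha> - 1) * Ln (1 + z) - (\<alpha> + 1) * Ln (1 - z))"
  define f where "f = (\<lambda>z. contour_integral (linepath 0 z) (\<lambda>t. exp (L t)))"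
  have dL: "(L has_field_derivative (2 * \<alpha> + 2 * z) / (1 - z\<^sup>2)) (at z)"
    if z: "z \<in> \<Delta>" for z :: complex
  proof -
    \<comment> \<open>Both 1 + z and 1 - z lie in the right half-plane, off the branch cut of
      \<open>Ln\<close>.\<close>
    have "\<bar>Re z\<bar> < 1"
      using z abs_Re_le_cmod[of z] by simp
    then have "1 + z \<notin> \<real>\<^sub>\<le>\<^sub>0" "1 - z \<notin> \<real>\<^sub>\<le>\<^sub>0" and nz: "1 + z \<noteq> 0" "1 - z \<noteq> 0"
      by (auto simp: complex_nonpos_Reals_iff complex_eq_iff)
    then have "(L has_field_derivative (\<alpha> - 1) * inverse (1 + z) + (\<alpha> + 1) * inverse (1 - z)) (at z)"
      unfolding L_def by (auto intro!: derivative_eq_intros)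
    also have "(\<alpha> - 1) * inverse (1 + z) + (\<alpha> + 1) * inverse (1 - z) =
        (2 * \<alpha> + 2 * z) / ((1 + z) * (1 - z))"
      using nz by (simp add: divide_simps) (simp add: algebra_simps)
    also have "(1 + z) * (1 - z) = 1 - z\<^sup>2"
      by (simp add: algebra_simps power2_eq_square)
    finally show ?thesis .
  qed
  then have L: "L holomorphic_on \<Delta>"
    unfolding holomorphic_on_open[OF open_ball] by blast
  have df: "(f has_field_derivative exp (L z)) (at z)" if "z \<in> \<Delta>" for z
    unfolding f_def using that
    by (intro has_field_derivative_contour_integral_linepath[of _ \<Delta>]) (auto intro!: holomorphic_intros L)
  note f' = DERIV_imp_deriv[OF df]
  have P: "deriv (deriv f) z / deriv f z = (2 * \<alpha> + 2 * z) / (1 - z\<^sup>2)"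
    if z: "z \<in> \<Delta>" for z :: complex
    using deriv_deriv_eqI[OF open_ball z df DERIV_chain2[OF DERIV_exp dL[OF z]]] f'[OF z] by simp
  have "f holomorphic_on \<Delta>"
    using df unfolding holomorphic_on_open[OF open_ball] by blast
  then have "f \<in> \<A>"
    unfolding normalized_functions_def using f'[of 0] by (simp add: f_def L_def)
  moreover have "cmod ((1 - (cmod b)\<^sup>2) * (deriv (deriv f) b / deriv f b) - 2 * cnj b) \<le> 2 * \<alpha>"
    if b: "b \<in> \<Delta>" for b :: complex
  proof -
    define k where "k = 1 - (cmod b)\<^sup>2"
    have nz: "1 - b\<^sup>2 \<noteq> 0"
      using one_minus_square_nonzero[OF b] .
    \<comment> \<open>Clearing the denominator 1 - b^2, the terms in |b|^2 b cancel and b - conj(b)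
      = 2 i Im b remains beside \<alpha> k.\<close>
    have "complex_of_real k * (2 * \<alpha> + 2 * b) - 2 * cnj b * (1 - b\<^sup>2) = 2 * Complex (\<alpha> * k) (2 * Im b)"
      unfolding k_def cmod_power2
      by (simp add: complex_eq_iff algebra_simps power2_eq_square)
    then have eq: "k * ((2 * \<alpha> + 2 * b) / (1 - b\<^sup>2)) - 2 * cnj b
        = 2 * Complex (\<alpha> * k) (2 * Im b) / (1 - b\<^sup>2)"
      using nz by (simp add: field_simps)
    \<comment> \<open>The factor 1 is kept visible to be raised to \<alpha>^2, which is where
      \<alpha> \<ge> 1 enters; \<open>cmod_one_minus_square\<close> then recognizes \<alpha>^2 |1 -
      b^2|^2.\<close>
    have "(cmod (Complex (\<alpha> * k) (2 * Im b)))\<^sup>2 = \<alpha>\<^sup>2 * k\<^sup>2 + 1 * (4 * (Im b)\<^sup>2)"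
      by (simp add: cmod_power2 power_mult_distrib)
    also have "\<dots> \<le> \<alpha>\<^sup>2 * k\<^sup>2 + \<alpha>\<^sup>2 * (4 * (Im b)\<^sup>2)"
      using assms by (intro add_left_mono mult_right_mono) auto
    also have "\<dots> = (\<alpha> * cmod (1 - b\<^sup>2))\<^sup>2"
      unfolding power_mult_distrib cmod_one_minus_square k_def by (simp add: distrib_left)
    finally have "cmod (Complex (\<alpha> * k) (2 * Im b)) \<le> \<alpha> * cmod (1 - b\<^sup>2)"
      by (rule power2_le_imp_le) (use assms in auto)
    then have "cmod (2 * Complex (\<alpha> * k) (2 * Im b) / (1 - b\<^sup>2)) \<le> 2 * \<alpha>"
      using nz by (simp add: norm_mult norm_divide pos_divide_le_eq)
    then show ?thesis
      unfolding P[OF b] k_def[symmetric] eq .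
  qed
  ultimately have "f \<in> \<U> \<alpha>"
    unfolding universal_lif_iff using f' by auto
  then show ?thesis
    using that P by blast
qed

section \<open>The equation for the radius, and both halves of the theorem\<close>

lemma convexity_radius_equation:
  fixes p q :: real
  assumes "p > 0" "q > 0"
  defines "r \<equiv> (sqrt (p\<^sup>2 + q) - p) / q"
  shows "r > 0" "q * r\<^sup>2 + 2 * p * r = 1"
proof -
  have "sqrt (p\<^sup>2) < sqrt (p\<^sup>2 + q)"
    using assms by (intro real_sqrt_less_mono) simp
  then show "r > 0"
    using assms by (simp add: r_def)
  \<comment> \<open>Completing the square: q (q r^2 + 2 p r) = (q r + p)^2 - p^2.\<close>
  have "q * r + p = sqrt (p\<^sup>2 + q)"
    using assms by (simp add: r_def)
  then have "(q * r + p)\<^sup>2 = p\<^sup>2 + q"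
    using assms by simp
  then have "q * (q * r\<^sup>2 + 2 * p * r) = q * 1"
    by (simp add: power2_eq_square algebra_simps)
  then show "q * r\<^sup>2 + 2 * p * r = 1"
    using assms by simp
qed

theorem theorem2p1:
  fixes n :: nat and \<alpha> :: "nat \<Rightarrow> real" and \<alpha>max M :: real
  assumes "n \<ge> 1"
    and "\<And>i. i \<in> {1..n} \<Longrightarrow> \<alpha> i \<ge> 1"
    and "\<alpha>max = Max (\<alpha> ` {1..n})"
    and "M > 0"
  shows "is_radius_of_convexity (integral_operator_class n \<alpha> M)
    ((sqrt (\<alpha>max\<^sup>2 * M\<^sup>2 + 2 * M + 1) - \<alpha>max * M) / (2 * M + 1))"
proof -
  define r where "r = (sqrt (\<alpha>max\<^sup>2 * M\<^sup>2 + 2 * M + 1) - \<alpha>max * M) / (2 * M + 1)"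
  have \<alpha>_le: "\<alpha> i \<le> \<alpha>max" if "i \<in> {1..n}" for i
    unfolding assms(3) using that by (intro Max_ge) auto
  have "\<alpha>max \<in> \<alpha> ` {1..n}"
    unfolding assms(3) using assms(1) by (intro Max_in) auto
  then obtain m where m: "m \<in> {1..n}" "\<alpha> m = \<alpha>max"
    by auto
  have \<alpha>max: "\<alpha>max \<ge> 1"
    using assms(2)[OF m(1)] m(2) by simp
  \<comment> \<open>With p = \<alpha>max M and q = 2 M + 1 the quadratic says r M (2 \<alpha>max + 2
    r) = 1 - r^2, the case of equality in the estimate below.\<close>
  have r: "r > 0" "(2 * M + 1) * r\<^sup>2 + 2 * (\<alpha>max * M) * r = 1"
    using convexity_radius_equation[of "\<alpha>max * M" "2 * M + 1"] assms(4) \<alpha>max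
    by (simp_all add: r_def power_mult_distrib add.assoc)
  have "r\<^sup>2 < 1"
  proof -
    have "0 < M * r\<^sup>2" "0 < \<alpha>max * M * r"
      using r(1) assms(4) \<alpha>max by simp_all
    then show ?thesis
      using r(2) by (simp add: algebra_simps)
  qed
  then have r1: "r < 1"
    using r(1) by (simp add: abs_square_less_1)

  have "convex_radius_admissible (integral_operator_class n \<alpha> M) r"
    unfolding convex_radius_admissible_def
  proof (intro conjI ballI allI impI)
    fix F z assume F: "F \<in> integral_operator_class n \<alpha> M" and z: "cmod z = r"
    then obtain f \<gamma> where F: "F = integral_operator n f \<gamma>"
      and f: "\<And>i. i \<in> {1..n} \<Longrightarrow> f i \<in> \<U> (\<alpha> i)" and \<gamma>: "(\<Sum>i=1..n. cmod (\<gamma> i)) \<le> M"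
      unfolding integral_operator_class_def by blast
    have z': "z \<in> \<Delta>"
      using z r1 by simp
    define p where "p = (\<lambda>i. deriv (deriv (f i)) z / deriv (f i) z)"
    \<comment> \<open>A bound common to all indices on the circle |z| = r: the individual bounds
      increase with \<alpha> i, so the maximum serves for each.\<close>
    define B where "B = (2 * \<alpha>max + 2 * r) / (1 - r\<^sup>2)"
    have p: "cmod (p i) \<le> B" if "i \<in> {1..n}" for i
    proof -
      have "cmod (p i) \<le> (2 * \<alpha> i + 2 * r) / (1 - r\<^sup>2)"
        using universal_lif_pre_schwarzian_bound[OF f[OF that] z'] by (simp add: p_def z)
      also have "\<dots> \<le> B"
        unfolding B_def using \<alpha>_le[OF that] \<open>r\<^sup>2 < 1\<close> by (intro divide_right_mono) auto
      finally show ?thesis .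
    qed
    have B0: "B \<ge> 0"
      unfolding B_def using \<alpha>max r(1) \<open>r\<^sup>2 < 1\<close> by simp
    have "cmod (z * (\<Sum>i=1..n. \<gamma> i * p i)) \<le> r * (\<Sum>i=1..n. cmod (\<gamma> i) * B)"
      unfolding norm_mult z using r(1) p
      by (intro mult_left_mono sum_norm_le) (auto simp: norm_mult intro!: mult_left_mono)
    also have "\<dots> \<le> r * (M * B)"
      unfolding sum_distrib_right[symmetric] using r(1) \<gamma> B0 by (intro mult_left_mono mult_right_mono) auto
    \<comment> \<open>The quadratic equation for \<open>r\<close>, divided by 1 - r^2.\<close>
    also have "\<dots> = 1"
      using r(2) \<open>r\<^sup>2 < 1\<close> by (simp add: B_def field_simps power2_eq_square)
    finally have "\<bar>Re (z * (\<Sum>i=1..n. \<gamma> i * p i))\<bar> \<le> 1"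
      using abs_Re_le_cmod order_trans by blast
    moreover have "deriv (deriv F) z / deriv F z = (\<Sum>i=1..n. \<gamma> i * p i)"
      unfolding F p_def using f z'
      by (intro integral_operator_pre_schwarzian) (auto simp: universal_lif_iff)
    ultimately show "Re (1 + z * deriv (deriv F) z / deriv F z) \<ge> 0"
      by (simp flip: times_divide_eq_right)
  qed (use r r1 in auto)

  moreover have "s \<le> r" if s: "convex_radius_admissible (integral_operator_class n \<alpha> M) s" for s
  proof -
    have s01: "0 < s" "s < 1"
      using s by (auto simp: convex_radius_admissible_def)
    \<comment> \<open>Membership in the class asks for a function at every index, also where the
      exponent will be 0.\<close>
    have "\<forall>i\<in>{1..n}. \<exists>f. f \<in> \<U> (\<alpha> i) \<and>
        (\<forall>z\<in>\<Delta>. deriv (deriv f) z / deriv f z = (2 * \<alpha> i + 2 * z) / (1 - z\<^sup>2))"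
      using generalized_koebe_function[OF assms(2)] by metis
    from bchoice[OF this] obtain f :: "nat \<Rightarrow> complex \<Rightarrow> complex"
      where f: "\<And>i. i \<in> {1..n} \<Longrightarrow> f i \<in> \<U> (\<alpha> i)"
      and fP: "\<And>i (z :: complex). i \<in> {1..n} \<Longrightarrow> z \<in> \<Delta> \<Longrightarrow>
        deriv (deriv (f i)) z / deriv (f i) z = (2 * \<alpha> i + 2 * z) / (1 - z\<^sup>2)"
      by blast
    \<comment> \<open>All the weight \<open>M\<close> goes to an index \<open>m\<close> of maximal
      order, with negative sign, so that at the positive point \<open>s\<close> the quotient F''/F'
      is real and as negative as the bound allows.\<close>
    define \<gamma> :: "nat \<Rightarrow> complex" where "\<gamma> = (\<lambda>i. if i = m then - of_real M else 0)"
    define F where "F = integral_operator n f \<gamma>"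
    have "(\<Sum>i=1..n. cmod (\<gamma> i)) = (\<Sum>i=1..n. if i = m then M else 0)"
      using assms(4) by (intro sum.cong) (auto simp: \<gamma>_def)
    also have "\<dots> = M"
      using m(1) by simp
    finally have "(\<Sum>i=1..n. cmod (\<gamma> i)) \<le> M"
      by simp
    with f have "F \<in> integral_operator_class n \<alpha> M"
      unfolding integral_operator_class_def F_def by blast
    then have Re: "Re (1 + of_real s * deriv (deriv F) s / deriv F s) \<ge> 0"
      using s s01 by (auto simp: convex_radius_admissible_def)
    have s': "complex_of_real s \<in> \<Delta>"
      using s01 by simp
    have "deriv (deriv F) s / deriv F s =
        (\<Sum>i=1..n. \<gamma> i * (deriv (deriv (f i)) s / deriv (f i) s))"
      unfolding F_def using f s'
      by (intro integral_operator_pre_schwarzian) (auto simp: universal_lif_iff)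
    also have "\<dots> = (\<Sum>i=1..n. if i = m then - of_real M * ((2 * \<alpha> i + 2 * s) / (1 - (complex_of_real s)\<^sup>2)) else 0)"
      using fP s' by (intro sum.cong) (auto simp: \<gamma>_def)
    also have "\<dots> = of_real (- M * ((2 * \<alpha>max + 2 * s) / (1 - s\<^sup>2)))"
      using m by simp
    finally have "0 \<le> 1 - s * M * ((2 * \<alpha>max + 2 * s) / (1 - s\<^sup>2))"
      using Re by (simp del: of_real_mult of_real_divide of_real_minus flip: times_divide_eq_right of_real_mult)
    moreover have "s\<^sup>2 < 1"
      using s01 by (simp add: abs_square_less_1)
    \<comment> \<open>Multiplication by 1 - s^2 > 0 yields the polynomial whose value at
      \<open>r\<close> is 1.\<close>
    ultimately have le: "(2 * M + 1) * s\<^sup>2 + 2 * (\<alpha>max * M) * s \<le> 1"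
      by (simp add: field_simps power2_eq_square)
    show ?thesis
    proof (rule ccontr)
      assume "\<not> s \<le> r"
      \<comment> \<open>Both terms of that polynomial increase strictly on the positive reals, so s
        > r would push its value above 1.\<close>
      then have "(2 * M + 1) * r\<^sup>2 < (2 * M + 1) * s\<^sup>2" "2 * (\<alpha>max * M) * r < 2 * (\<alpha>max * M) * s"
        using r(1) assms(4) \<alpha>max by (auto intro!: power_strict_mono)
      then show False
        using le r(2) by linarith
    qed
  qed
  ultimately show ?thesis
    unfolding is_radius_of_convexity_def r_def by blast
qed

end
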